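(* Let $F \subseteq \mathbb{N}$ be the set of natural numbers whose base-$2$ expansion has even length and begins with $11$. Then the lower density of $F$ is $1/9$ and the upper density of $F$ is $1/3$.
   Context: $\mathbb{N} = \{0,1,2,\ldots\}$. Base-$2$ expansions are written without leading zeros, most significant digit first; thus $F = \{3,12,13,14,15,48,49,50,\ldots,63,192,\ldots\} = \bigcup_{i \geq 0} \{m \in \mathbb{N} : 3\cdot 4^i \leq m < 4^{i+1}\}$. For $X \subseteq \mathbb{N}$ and $n \geq 1$, let $D_X(n) = \frac{1}{n} |X \cap \{0,1,\ldots,n-1\}|$. The lower density of $X$ is $\liminf_{n\to\infty} D_X(n)$ and the upper density of $X$ is $\limsup_{n\to\infty} D_X(n)$. *)

theory Defs
  imports Complex_Main "HOL-Library.Sublist" "HOL-Library.Extended_Real" "HOL-Library.Liminf_Limsup"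
begin

(* Most significant digit first, no leading zeros; 0 has the empty expansion. *)
fun binary_expansion :: "nat \<Rightarrow> nat list" where
  "binary_expansion n = (if n = 0 then [] else binary_expansion (n div 2) @ [n mod 2])"

declare binary_expansion.simps [simp del]

definition F :: "nat set" where
  "F = {m. even (length (binary_expansion m)) \<and> prefix [1, 1] (binary_expansion m)}"

definition initial_density :: "nat set \<Rightarrow> nat \<Rightarrow> real" where
  "initial_density X n = real (card (X \<inter> {0..<n})) / real n"

(* The value of initial_density at n = 0 is irrelevant to the limits below.
   They are taken in ereal because liminf and limsup need a complete lattice. *)
definition lower_density :: "nat set \<Rightarrow> ereal" where
  "lower_density X = liminf (\<lambda>n. ereal (initial_density X n))"

definition upper_density :: "nat set \<Rightarrow> ereal" where
  "upper_density X = limsup (\<lambda>n. ereal (initial_density X n))"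

lemma binary_expansion_value: "horner_sum (\<lambda>d. d) 2 (rev (binary_expansion n)) = n"
  by (induction n rule: binary_expansion.induct) (subst binary_expansion.simps, simp)

lemma binary_expansion_digits: "set (binary_expansion n) \<subseteq> {0, 1}"
proof (induction n rule: binary_expansion.induct)
  case (1 n)
  then show ?case by (subst binary_expansion.simps) auto
qed

lemma binary_expansion_no_leading_zero: "n > 0 \<Longrightarrow> hd (binary_expansion n) = 1"
proof (induction n rule: binary_expansion.induct)
  case (1 n)
  show ?case
  proof (cases "n = 1")
    case True
    then show ?thesis by (simp add: binary_expansion.simps)
  next
    case False
    with 1 have "n div 2 > 0" by auto
    moreover from this have "binary_expansion (n div 2) \<noteq> []"
      by (subst binary_expansion.simps) simp
    ultimately show ?thesis
      using 1 by (subst binary_expansion.simps) (simp add: hd_append)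
  qed
qed

lemma F_step: "m \<ge> 4 \<Longrightarrow> m \<in> F \<longleftrightarrow> m div 4 \<in> F"
proof -
  assume m: "m \<ge> 4"
  have e: "binary_expansion m = binary_expansion (m div 4) @ [m div 2 mod 2, m mod 2]"
    using m by (subst binary_expansion.simps, subst binary_expansion.simps)
      (simp add: div_mult2_eq [symmetric])
  have ne: "binary_expansion (m div 4) \<noteq> []"
    using m by (subst binary_expansion.simps) simp
  have "even (length xs) \<Longrightarrow> xs \<noteq> [] \<Longrightarrow> prefix [1, 1] (xs @ [a, b]) \<longleftrightarrow> prefix [1, 1] xs"
    for xs :: "nat list" and a b
    by (cases xs; cases "tl xs") auto
  then show ?thesis
    using ne unfolding F_def mem_Collect_eq e by (simp cong: conj_cong)
qed

lemma F_eq_Union: "F = (\<Union>i. {m. 3 * 4 ^ i \<le> m \<and> m < 4 ^ (i + 1)})"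
proof -
  have "m \<in> F \<longleftrightarrow> (\<exists>i. 3 * 4 ^ i \<le> m \<and> m < 4 ^ (i + 1))" for m
  proof (induction m rule: less_induct)
    case (less m)
    show ?case
    proof (cases "m \<ge> 4")
      case True
      have "m \<in> F \<longleftrightarrow> (\<exists>i. 3 * 4 ^ i \<le> m div 4 \<and> m div 4 < 4 ^ (i + 1))"
        using F_step [OF True] less.IH [of "m div 4"] True by simp
      also have "\<dots> \<longleftrightarrow> (\<exists>i. 3 * 4 ^ Suc i \<le> m \<and> m < 4 ^ (Suc i + 1))"
        by (simp add: less_eq_div_iff_mult_less_eq div_less_iff_less_mult mult_ac)
      also have "\<dots> \<longleftrightarrow> (\<exists>i. 3 * 4 ^ i \<le> m \<and> m < 4 ^ (i + 1))"
      proof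
        assume "\<exists>i. 3 * 4 ^ i \<le> m \<and> m < 4 ^ (i + 1)"
        then obtain i where i: "3 * 4 ^ i \<le> m" "m < 4 ^ (i + 1)" by blast
        with True show "\<exists>i. 3 * 4 ^ Suc i \<le> m \<and> m < 4 ^ (Suc i + 1)"
          by (cases i) auto
      qed blast
      finally show ?thesis .
    next
      case False
      have "0 \<notin> F" "1 \<notin> F" "2 \<notin> F" "3 \<in> F"
        by (simp_all add: F_def binary_expansion.simps)
      moreover from False have "m = 0 \<or> m = 1 \<or> m = 2 \<or> m = 3" by linarith
      ultimately have l: "m \<in> F \<longleftrightarrow> m = 3" by auto
      have "m = 3" if "3 * 4 ^ i \<le> m" for i
        using that False one_le_power [of "4::nat" i] by linarith
      with l show ?thesis by (auto intro: exI [of _ 0])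
    qed
  qed
  then show ?thesis by auto
qed

end

theory Submission imports Defs begin

text \<open>
  Write \<open>A n\<close> for the number of elements of \<open>F\<close> below \<open>n\<close>. On a block \<open>[4^k, 4^(k+1)]\<close> the count
  \<open>A\<close> stays constant up to \<open>3 * 4^k\<close> and then grows with slope one; since every block contributes
  \<open>4^k\<close> elements, the geometric sum gives \<open>3 * A (4^k) + 1 = 4^k\<close>. The ratio \<open>A n / n\<close> is therefore
  smallest within a block at the end of the flat part and largest at the end of the block.
  This yields, for all \<open>n \<ge> 1\<close>,
  \<open>1/9 - 1/(3n) \<le> A n / n \<le> 1/3 - 1/(3n)\<close>,
  where the left inequality is an equality at every \<open>n = 3 * 4^k\<close> and the right one at every
  \<open>n = 4^k\<close>. A convergent bound that is attained along a subsequence determines the lower or upper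
  limit, so the two densities are the limits of the two bounds.
\<close>

lemma mem_F_in_block:
  assumes "4 ^ k \<le> m" "m < 4 ^ Suc k"
  shows "m \<in> F \<longleftrightarrow> 3 * 4 ^ k \<le> m"
proof
  assume "m \<in> F"
  then obtain i where i: "3 * 4 ^ i \<le> m" "m < 4 ^ Suc i"
    unfolding F_eq_Union by auto
  have "(4::nat) ^ i < 4 ^ Suc k" "(4::nat) ^ k < 4 ^ Suc i"
    using assms i by linarith+
  then have "i = k"
    by (simp only: power_strict_increasing_iff)
  with i show "3 * 4 ^ k \<le> m" by simp
next
  assume "3 * 4 ^ k \<le> m"
  with assms(2) show "m \<in> F"
    unfolding F_eq_Union by auto
qed

text \<open>
  The truncated difference \<open>n - 3 * 4 ^ k\<close> of natural numbers vanishes exactly on the flat part of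
  the block, so that one formula covers both parts.
\<close>

lemma card_F_below_in_block:
  assumes "4 ^ k \<le> n" "n \<le> 4 ^ Suc k"
  shows "card (F \<inter> {0..<n}) = card (F \<inter> {0..<4 ^ k}) + (n - 3 * 4 ^ k)"
proof -
  have "m \<in> F \<inter> {0..<n} \<longleftrightarrow> m \<in> (F \<inter> {0..<4 ^ k}) \<union> {3 * 4 ^ k..<n}" for m
    using assms mem_F_in_block[of k m] by (cases "m < 4 ^ k") auto
  then have "F \<inter> {0..<n} = (F \<inter> {0..<4 ^ k}) \<union> {3 * 4 ^ k..<n}"
    by blast
  moreover have "(F \<inter> {0..<4 ^ k}) \<inter> {3 * 4 ^ k..<n} = {}"
    by auto
  ultimately show ?thesis
    by (simp add: card_Un_disjoint)
qed

lemma card_F_below_power4: "3 * card (F \<inter> {0..<4 ^ k}) + 1 = 4 ^ k"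
proof (induction k)
  case 0
  have "0 \<notin> F"
    by (auto simp: F_eq_Union)
  then have "F \<inter> {0..<1} = {}"
    by auto
  then show ?case by simp
next
  case (Suc k)
  then show ?case
    using card_F_below_in_block[of k "4 ^ Suc k"] by simp
qed

lemma card_F_below_3_power4: "9 * card (F \<inter> {0..<3 * 4 ^ k}) + 3 = 3 * 4 ^ k"
  using card_F_below_in_block[of k "3 * 4 ^ k"] card_F_below_power4[of k] by simp

lemma card_F_below_bounds:
  assumes "n \<ge> 1"
  shows "n \<le> 9 * card (F \<inter> {0..<n}) + 3" "3 * card (F \<inter> {0..<n}) + 1 \<le> n"
proof -
  obtain k where k: "4 ^ k \<le> n" "n < 4 ^ Suc k"
    using ex_power_ivl1[of 4 n] assms by auto
  have count: "3 * card (F \<inter> {0..<n}) + 1 = 4 ^ k + 3 * (n - 3 * 4 ^ k)"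
    using card_F_below_in_block[of k n] card_F_below_power4[of k] k by simp
  show "n \<le> 9 * card (F \<inter> {0..<n}) + 3"
    using count by linarith
  show "3 * card (F \<inter> {0..<n}) + 1 \<le> n"
    using count k by (cases "n \<le> 3 * 4 ^ k") auto
qed

text \<open>
  The bound keeps \<open>liminf f\<close> from being smaller than \<open>l\<close>; along \<open>r\<close> the function \<open>f\<close> coincides with a
  subsequence of \<open>b\<close>, which tends to \<open>l\<close>, and this keeps \<open>liminf f\<close> from being larger.
\<close>

lemma liminf_eq_limit_of_attained_bound:
  fixes b f :: "nat \<Rightarrow> ereal" and r :: "nat \<Rightarrow> nat"
  assumes "b \<longlonglongrightarrow> l" "strict_mono r"
    and bound: "\<forall>\<^sub>F n in sequentially. b n \<le> f n"
    and attained: "\<And>k. f (r k) = b (r k)"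
  shows "liminf f = l"
proof (rule antisym)
  have "(b \<circ> r) \<longlonglongrightarrow> l"
    using assms by (intro LIMSEQ_subseq_LIMSEQ)
  moreover have "f \<circ> r = b \<circ> r"
    using attained by auto
  ultimately have "liminf (f \<circ> r) = l"
    by (metis lim_imp_Liminf sequentially_bot)
  then show "liminf f \<le> l"
    using liminf_subseq_mono[OF \<open>strict_mono r\<close>] by metis
  have "liminf b = l"
    using assms(1) by (intro lim_imp_Liminf) simp_all
  then show "l \<le> liminf f"
    using Liminf_mono[OF bound] by simp
qed

lemma limsup_eq_limit_of_attained_bound:
  fixes b f :: "nat \<Rightarrow> ereal" and r :: "nat \<Rightarrow> nat"
  assumes "b \<longlonglongrightarrow> l" "strict_mono r"
    and bound: "\<forall>\<^sub>F n in sequentially. f n \<le> b n"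
    and attained: "\<And>k. f (r k) = b (r k)"
  shows "limsup f = l"
proof -
  have "liminf (\<lambda>n. - f n) = - l"
    using assms by (intro liminf_eq_limit_of_attained_bound[of "\<lambda>n. - b n" _ r]) auto
  then show ?thesis
    by (simp add: ereal_Liminf_uminus)
qed

lemma tendsto_ereal_diff_third_inverse:
  "(\<lambda>n. ereal (c - 1 / (3 * real n))) \<longlonglongrightarrow> ereal c"
proof -
  have "(\<lambda>n. c - (1 / 3) * inverse (real n)) \<longlonglongrightarrow> c - (1 / 3) * 0"
    by (intro tendsto_intros lim_inverse_n)
  then show ?thesis
    by (simp add: divide_simps)
qed

theorem proposition1:
  "lower_density F = ereal (1 / 9) \<and> upper_density F = ereal (1 / 3)"
proof
  have density_le: "initial_density F n \<le> 1 / 3 - 1 / (3 * real n)"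
    and le_density: "1 / 9 - 1 / (3 * real n) \<le> initial_density F n" if "n \<ge> 1" for n
  proof -
    have "real n \<le> 9 * real (card (F \<inter> {0..<n})) + 3"
      "3 * real (card (F \<inter> {0..<n})) + 1 \<le> real n"
      using card_F_below_bounds[OF that] by linarith+
    moreover have "1 / 9 - 1 / (3 * real n) = (real n - 3) / 9 / real n"
      "1 / 3 - 1 / (3 * real n) = (real n - 1) / 3 / real n"
      using that by (simp_all add: field_simps)
    ultimately show "initial_density F n \<le> 1 / 3 - 1 / (3 * real n)"
      "1 / 9 - 1 / (3 * real n) \<le> initial_density F n"
      by (simp_all only: initial_density_def) (intro divide_right_mono; simp)+
  qed
  have density_3_power4:
    "initial_density F (3 * 4 ^ k) = 1 / 9 - 1 / (3 * real (3 * 4 ^ k))" for k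
  proof -
    have "9 * real (card (F \<inter> {0..<3 * 4 ^ k})) + 3 = 3 * 4 ^ k"
      using arg_cong[OF card_F_below_3_power4[of k], of real] by simp
    then show ?thesis
      by (simp add: initial_density_def field_simps)
  qed
  have density_power4: "initial_density F (4 ^ k) = 1 / 3 - 1 / (3 * real (4 ^ k))" for k
  proof -
    have "3 * real (card (F \<inter> {0..<4 ^ k})) + 1 = 4 ^ k"
      using arg_cong[OF card_F_below_power4[of k], of real] by simp
    then show ?thesis
      by (simp add: initial_density_def field_simps)
  qed
  show "lower_density F = ereal (1 / 9)"
    unfolding lower_density_def
  proof (rule liminf_eq_limit_of_attained_bound)
    show "\<forall>\<^sub>F n in sequentially. ereal (1 / 9 - 1 / (3 * real n)) \<le> ereal (initial_density F n)"
      using eventually_ge_at_top[of "1::nat"] by eventually_elim (simp only: ereal_less_eq le_density)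
    show "strict_mono (\<lambda>k. 3 * 4 ^ k :: nat)"
      by (rule strict_monoI) simp
  qed (simp_all only: density_3_power4 tendsto_ereal_diff_third_inverse)
  show "upper_density F = ereal (1 / 3)"
    unfolding upper_density_def
  proof (rule limsup_eq_limit_of_attained_bound)
    show "\<forall>\<^sub>F n in sequentially. ereal (initial_density F n) \<le> ereal (1 / 3 - 1 / (3 * real n))"
      using eventually_ge_at_top[of "1::nat"] by eventually_elim (simp only: ereal_less_eq density_le)
    show "strict_mono (\<lambda>k. 4 ^ k :: nat)"
      by (rule strict_monoI) simp
  qed (simp_all only: density_power4 tendsto_ereal_diff_third_inverse)
qed

end
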